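(* Let $G$ be a locally compact group. (a) Let $1<p<q<\infty$. If $G$ is $(q,q)$-amenable, then $G$ is $(p,q)$-amenable; and if $G$ is $(p,q)$-amenable, then $G$ is $(1,q)$-amenable. (b) Let $1\le p<\infty$. If $G$ is $(p,p)$-amenable, then $G$ is $(q,q)$-amenable for all $q$ with $p\le q<\infty$.
   Context: $m$ is a left Haar measure on $G$, $L^1(G)=L^1(G,m)$. Weak $(p,q)$-multi-norm. For a Banach space $X$, $1\le p<\infty$ and $x=(x_1,\dots,x_n)\in X^n$, put $\mu_{p,n}(x)=\sup\{(\sum_{i=1}^n|\langle x_i,\lambda\rangle|^p)^{1/p}:\lambda\in X',\ \|\lambda\|\le1\}$. For $1\le p\le q<\infty$ and $x\in X^n$, put $$\|x\|_n^{(p,q)}=\sup\Big\{\Big(\sum_{i=1}^n|\langle x_i,\lambda_i\rangle|^q\Big)^{1/q}:\lambda=(\lambda_1,\dots,\lambda_n)\in (X')^n,\ \mu_{p,n}(\lambda)\le1\Big\}.$$ $(p,q)$-amenability. For $f\in L^1(G)$, $s\in G$, let $(s\cdot f)(t)=f(s^{-1}t)$; this action of $G$ is extended to $L^1(G)''$ by taking second adjoints. A mean is an element $\Lambda\in L^1(G)''$ with $\langle 1,\Lambda\rangle=\|\Lambda\|=1$, where $1\in L^\infty(G)$ is the constant function. For $1\le p\le q<\infty$, $G$ is $(p,q)$-amenable if there is a mean $\Lambda$ which is left $(p,q)$-multi-invariant, i.e. $\sup\{\|(s_1\cdot\Lambda,\dots,s_n\cdot\Lambda)\|_n^{(p,q)}:s_1,\dots,s_n\in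 G,\ n\in\mathbb N\}<\infty$, where the weak $(p,q)$-multi-norm is taken over the Banach space $X=L^1(G)''$. *)

theory Defs
  imports "HOL-Analysis.Analysis"
begin

text \<open>
  Groups are written additively because the library's class of topological groups is
  \<open>topological_group_add\<close>; addition in that class is not assumed to be commutative, so
  \<open>s + t\<close> is the group product and \<open>- s\<close> the inverse.

  A left Haar measure is a nonzero left-invariant Radon measure on the Borel sets: finite on compact
  sets, outer regular on Borel sets and inner regular on open sets.
\<close>

definition left_haar_measure :: "'a::topological_group_add measure \<Rightarrow> bool" where
  "left_haar_measure m \<longleftrightarrow>
     sets m = sets borel \<and>
     emeasure m UNIV \<noteq> 0 \<and>
     (\<forall>K. compact K \<longrightarrow> emeasure m K < \<infinity>) \<and>
     (\<forall>A\<in>sets borel. emeasure m A = (INF U\<in>{U. open U \<and> A \<subseteq> U}. emeasure m U)) \<and>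
     (\<forall>U. open U \<longrightarrow> emeasure m U = (SUP K\<in>{K. compact K \<and> K \<subseteq> U}. emeasure m K)) \<and>
     (\<forall>s. \<forall>A\<in>sets borel. emeasure m ((\<lambda>t. s + t) ` A) = emeasure m A)"

text \<open>
  A complex (semi)normed space is represented by a set of complex-valued functions, with pointwise
  addition and scalar multiplication, and a seminorm on it. \<open>L1 m\<close> consists of integrable functions
  rather than of their classes modulo null functions; a functional that is bounded for the seminorm
  is constant on these classes, so the dual is that of the quotient Banach space.
\<close>

record 'b fspace =
  vecs :: "('b \<Rightarrow> complex) set"
  vnorm :: "('b \<Rightarrow> complex) \<Rightarrow> real"

definition L1 :: "'a measure \<Rightarrow> 'a fspace" where
  "L1 m = \<lparr>vecs = {f. integrable m f}, vnorm = (\<lambda>f. \<integral>t. cmod (f t) \<partial>m)\<rparr>"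

text \<open>
  The topological dual. Functionals vanish outside the space, so that each one is represented by
  exactly one function and the dual is closed under the pointwise operations.
\<close>

definition dual :: "'b fspace \<Rightarrow> ('b \<Rightarrow> complex) fspace" where
  "dual X =
     \<lparr>vecs = {\<phi>. (\<forall>x\<in>vecs X. \<forall>y\<in>vecs X. \<phi> (\<lambda>t. x t + y t) = \<phi> x + \<phi> y) \<and>
                 (\<forall>c. \<forall>x\<in>vecs X. \<phi> (\<lambda>t. c * x t) = c * \<phi> x) \<and>
                 (\<exists>C. \<forall>x\<in>vecs X. cmod (\<phi> x) \<le> C * vnorm X x) \<and>
                 (\<forall>x. x \<notin> vecs X \<longrightarrow> \<phi> x = 0)},
      vnorm = (\<lambda>\<phi>. SUP x\<in>{x \<in> vecs X. vnorm X x \<le> 1}. cmod (\<phi> x))\<rparr>"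

definition adjoint_op ::
  "'b fspace \<Rightarrow> (('b \<Rightarrow> complex) \<Rightarrow> ('c \<Rightarrow> complex)) \<Rightarrow>
   (('c \<Rightarrow> complex) \<Rightarrow> complex) \<Rightarrow> (('b \<Rightarrow> complex) \<Rightarrow> complex)" where
  "adjoint_op X T \<phi> = (\<lambda>x. if x \<in> vecs X then \<phi> (T x) else 0)"

text \<open>
  Tuples \<open>x\<^sub>1, \<dots>, x\<^sub>n\<close> are functions on \<open>nat\<close> of which only the values at \<open>i < n\<close> matter. Suprema are
  taken in \<open>[0, \<infinity>]\<close>.
\<close>

definition weak_summing_norm :: "real \<Rightarrow> nat \<Rightarrow> 'b fspace \<Rightarrow> (nat \<Rightarrow> 'b \<Rightarrow> complex) \<Rightarrow> ennreal" where
  "weak_summing_norm p n X x =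
     (SUP l\<in>{l \<in> vecs (dual X). vnorm (dual X) l \<le> 1}.
        ennreal ((\<Sum>i<n. cmod (l (x i)) powr p) powr (1 / p)))"

definition weak_pq_multi_norm ::
  "real \<Rightarrow> real \<Rightarrow> nat \<Rightarrow> 'b fspace \<Rightarrow> (nat \<Rightarrow> 'b \<Rightarrow> complex) \<Rightarrow> ennreal" where
  "weak_pq_multi_norm p q n X x =
     (SUP l\<in>{l. (\<forall>i<n. l i \<in> vecs (dual X)) \<and> weak_summing_norm p n (dual X) l \<le> 1}.
        ennreal ((\<Sum>i<n. cmod (l i (x i)) powr q) powr (1 / q)))"

definition left_translate :: "'a::group_add \<Rightarrow> ('a \<Rightarrow> complex) \<Rightarrow> ('a \<Rightarrow> complex)" where
  "left_translate s f = (\<lambda>t. f (- s + t))"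

definition bidual_L1 :: "'a measure \<Rightarrow> (('a \<Rightarrow> complex) \<Rightarrow> complex) fspace" where
  "bidual_L1 m = dual (dual (L1 m))"

definition bidual_action ::
  "'a::group_add measure \<Rightarrow> 'a \<Rightarrow>
   ((('a \<Rightarrow> complex) \<Rightarrow> complex) \<Rightarrow> complex) \<Rightarrow> ((('a \<Rightarrow> complex) \<Rightarrow> complex) \<Rightarrow> complex)" where
  "bidual_action m s = adjoint_op (dual (L1 m)) (adjoint_op (L1 m) (left_translate s))"

text \<open>The functional on \<open>L1 m\<close> given by integration against a bounded measurable function \<open>g\<close>.\<close>

definition Linf_functional :: "'a measure \<Rightarrow> ('a \<Rightarrow> complex) \<Rightarrow> (('a \<Rightarrow> complex) \<Rightarrow> complex)" where
  "Linf_functional m g = (\<lambda>f. if f \<in> vecs (L1 m) then \<integral>t. f t * g t \<partial>m else 0)"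

definition is_mean :: "'a measure \<Rightarrow> ((('a \<Rightarrow> complex) \<Rightarrow> complex) \<Rightarrow> complex) \<Rightarrow> bool" where
  "is_mean m \<Lambda> \<longleftrightarrow>
     \<Lambda> \<in> vecs (bidual_L1 m) \<and> \<Lambda> (Linf_functional m (\<lambda>_. 1)) = 1 \<and> vnorm (bidual_L1 m) \<Lambda> = 1"

definition left_multi_invariant ::
  "'a::group_add measure \<Rightarrow> real \<Rightarrow> real \<Rightarrow> ((('a \<Rightarrow> complex) \<Rightarrow> complex) \<Rightarrow> complex) \<Rightarrow> bool" where
  "left_multi_invariant m p q \<Lambda> \<longleftrightarrow>
     Sup {weak_pq_multi_norm p q n (bidual_L1 m) (\<lambda>i. bidual_action m (s i) \<Lambda>) |n s. n \<ge> 1} < \<infinity>"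

definition pq_amenable :: "'a::group_add measure \<Rightarrow> real \<Rightarrow> real \<Rightarrow> bool" where
  "pq_amenable m p q \<longleftrightarrow> (\<exists>\<Lambda>. is_mean m \<Lambda> \<and> left_multi_invariant m p q \<Lambda>)"

end

theory Submission
  imports Defs
begin

text \<open>
  Both parts are inequalities between multi-norms on an arbitrary space. For (a), the weak
  \<open>p\<close>-summing norm decreases in \<open>p\<close>, so the unit ball defining the \<open>(p,q)\<close>-multi-norm grows with
  \<open>p\<close>. For (b), one argues as in the inclusion theorem for \<open>p\<close>-summing operators: given functionals
  \<open>l\<^sub>i\<close> of weak \<open>q\<close>-summing norm at most \<open>1\<close>, put \<open>a\<^sub>i = |l\<^sub>i(x\<^sub>i)|\<close> and \<open>S = \<Sum>\<^sub>i a\<^sub>i\<^sup>q\<close>. By Young's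
  inequality the rescaled functionals \<open>(a\<^sub>i\<^sup>q / S)\<^bsup>1/p - 1/q\<^esup> l\<^sub>i\<close> have weak \<open>p\<close>-summing norm at most
  \<open>1\<close>, and the \<open>\<ell>\<^sup>p\<close>-norm of their values at the \<open>x\<^sub>i\<close> is again \<open>S\<^bsup>1/q\<^esup>\<close>.
\<close>

lemma powr_inverse_le_one_iff:
  fixes a p :: real
  assumes "p > 0" "a \<ge> 0"
  shows "a powr (1 / p) \<le> 1 \<longleftrightarrow> a \<le> 1"
proof
  assume "a powr (1 / p) \<le> 1"
  then have "(a powr (1 / p)) powr p \<le> 1 powr p"
    using assms by (intro powr_mono2) auto
  then show "a \<le> 1"
    using assms by (simp add: powr_powr)
next
  assume "a \<le> 1"
  then show "a powr (1 / p) \<le> 1"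
    using assms powr_mono2[of "1 / p" a 1] by simp
qed

text \<open>Only the unit ball of the weak summing norm enters the multi-norm, so the outer root and
  \<open>ennreal\<close> are removed here once for all later estimates.\<close>

lemma weak_summing_norm_le_one_iff:
  assumes "p > 0"
  shows "weak_summing_norm p n X x \<le> 1 \<longleftrightarrow>
    (\<forall>l\<in>vecs (dual X). vnorm (dual X) l \<le> 1 \<longrightarrow> (\<Sum>i<n. cmod (l (x i)) powr p) \<le> 1)"
  using assms
  by (auto simp: weak_summing_norm_def SUP_le_iff powr_inverse_le_one_iff sum_nonneg)

text \<open>Each summand is at most the whole sum, so every \<open>b i\<close> lies in [0, 1], where
  powers decrease in the exponent.\<close>

lemma sum_powr_le_one_mono:
  fixes b :: "'i \<Rightarrow> real"
  assumes "finite I" "\<And>i. i \<in> I \<Longrightarrow> b i \<ge> 0" "0 < p" "p \<le> q" "(\<Sum>i\<in>I. b i powr p) \<le> 1"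
  shows "(\<Sum>i\<in>I. b i powr q) \<le> 1"
proof -
  have "b i powr q \<le> b i powr p" if "i \<in> I" for i
  proof -
    have "b i powr p \<le> (\<Sum>i\<in>I. b i powr p)"
      using assms that by (intro member_le_sum) auto
    then have "b i powr p \<le> 1"
      using assms by linarith
    then have "b i \<le> 1"
      \<comment> \<open>Here \<open>b i powr p\<close> is read as a root, with exponent
        \<open>1 / (1 / p)\<close>.\<close>
      using powr_inverse_le_one_iff[of "1 / p" "b i"] assms(2)[OF that] \<open>0 < p\<close> by simp
    then show ?thesis
      using assms that by (intro powr_mono') auto
  qed
  then have "(\<Sum>i\<in>I. b i powr q) \<le> (\<Sum>i\<in>I. b i powr p)"
    by (rule sum_mono)
  with assms(5) show ?thesis
    by linarith
qed

lemma weak_pq_multi_norm_mono: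
  assumes "0 < p" "p \<le> r"
  shows "weak_pq_multi_norm p q n X x \<le> weak_pq_multi_norm r q n X x"
proof -
  have "weak_summing_norm r n (dual X) l \<le> 1" if "weak_summing_norm p n (dual X) l \<le> 1" for l
    using that assms by (auto simp: weak_summing_norm_le_one_iff intro: sum_powr_le_one_mono)
  then show ?thesis
    unfolding weak_pq_multi_norm_def by (intro SUP_subset_mono) auto
qed

text \<open>A zero factor is harmless even with exponent 0, since
  \<open>0 powr 0 = 0\<close>.\<close>

lemma Youngs_inequality_nonneg:
  fixes a b :: real
  assumes "0 \<le> \<alpha>" "0 \<le> \<beta>" "\<alpha> + \<beta> = 1" "a \<ge> 0" "b \<ge> 0"
  shows "a powr \<alpha> * b powr \<beta> \<le> \<alpha> * a + \<beta> * b"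
  using Youngs_inequality_0[of \<alpha> \<beta> a b] assms by (cases "a = 0 \<or> b = 0") auto

lemma scaled_in_dual:
  assumes "l \<in> vecs (dual X)"
  shows "(\<lambda>t. c * l t) \<in> vecs (dual X)"
proof -
  obtain C where "\<forall>x\<in>vecs X. cmod (l x) \<le> C * vnorm X x"
    using assms by (auto simp: dual_def)
  then have "\<forall>x\<in>vecs X. cmod (c * l x) \<le> (cmod c * C) * vnorm X x"
    by (auto simp: norm_mult mult.assoc intro!: mult_left_mono)
  then have "\<exists>D. \<forall>x\<in>vecs X. cmod (c * l x) \<le> D * vnorm X x"
    by blast
  then show ?thesis
    using assms by (simp add: dual_def distrib_left mult.left_commute)
qed

lemma dual_scaled:
  assumes "\<phi> \<in> vecs (dual X)" "x \<in> vecs X"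
  shows "\<phi> (\<lambda>t. c * x t) = c * \<phi> x"
  using assms by (auto simp: dual_def)

lemma weak_pp_multi_norm_antimono:
  assumes "0 < p" "p \<le> q"
  shows "weak_pq_multi_norm q q n X x \<le> weak_pq_multi_norm p p n X x"
  unfolding weak_pq_multi_norm_def
proof (rule SUP_mono, safe)
  fix l
  assume dual: "\<forall>i<n. l i \<in> vecs (dual X)" and weak: "weak_summing_norm q n (dual X) l \<le> 1"
  define a where "a i = cmod (l i (x i))" for i
  define S where "S = (\<Sum>i<n. a i powr q)"
  \<comment> \<open>The exponent turns \<open>c i powr p\<close> into the power
    \<open>1 - p / q\<close> of the weight \<open>a i powr q / S\<close>. The weights over
    \<open>i < n\<close> sum to 1 unless \<open>S = 0\<close>, in which case division by zero makes
    every \<open>c i\<close> zero.\<close>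
  define c where "c i = (a i powr q / S) powr (1 / p - 1 / q)" for i
  define l' where "l' i = (\<lambda>t. of_real (c i) * l i t)" for i
  have "a i \<ge> 0" for i
    by (simp add: a_def)
  have "S \<ge> 0"
    by (simp add: S_def sum_nonneg)
  have "c i \<ge> 0" for i
    by (simp add: c_def)
  have dual': "\<forall>i<n. l' i \<in> vecs (dual X)"
    using dual by (simp add: l'_def scaled_in_dual)
  have exps: "(1 / p - 1 / q) * p = 1 - p / q" "p / q > 0" "1 - p / q \<ge> 0"
    using assms by (auto simp: field_simps)
  have cp: "c i powr p = (a i powr q / S) powr (1 - p / q)" for i
    by (simp add: c_def powr_powr exps(1))
  have "weak_summing_norm p n (dual X) l' \<le> 1"
    unfolding weak_summing_norm_le_one_iff[OF \<open>0 < p\<close>]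
  proof (intro ballI impI)
    fix \<phi>
    assume \<phi>: "\<phi> \<in> vecs (dual (dual X))" "vnorm (dual (dual X)) \<phi> \<le> 1"
    define b where "b i = cmod (\<phi> (l i))" for i
    have b: "(\<Sum>i<n. b i powr q) \<le> 1"
      using weak \<phi> assms by (simp add: weak_summing_norm_le_one_iff b_def)
    have "cmod (\<phi> (l' i)) powr p \<le> (1 - p / q) * (a i powr q / S) + (p / q) * b i powr q"
      if "i < n" for i
    proof -
      have "cmod (\<phi> (l' i)) = c i * b i"
        using dual that \<phi>(1) \<open>c i \<ge> 0\<close> by (simp add: l'_def dual_scaled norm_mult b_def)
      then have "cmod (\<phi> (l' i)) powr p =
          (a i powr q / S) powr (1 - p / q) * (b i powr q) powr (p / q)"
        using \<open>c i \<ge> 0\<close> assms by (simp add: powr_mult cp powr_powr b_def)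
      \<comment> \<open>Young's inequality trades the product for a convex combination of two terms,
        each of which has sum at most 1 over \<open>i < n\<close>.\<close>
      also have "\<dots> \<le> (1 - p / q) * (a i powr q / S) + (p / q) * b i powr q"
        using \<open>S \<ge> 0\<close> exps by (intro Youngs_inequality_nonneg) auto
      finally show ?thesis .
    qed
    then have "(\<Sum>i<n. cmod (\<phi> (l' i)) powr p) \<le>
        (\<Sum>i<n. (1 - p / q) * (a i powr q / S) + (p / q) * b i powr q)"
      by (intro sum_mono) auto
    also have "\<dots> = (1 - p / q) * (S / S) + (p / q) * (\<Sum>i<n. b i powr q)"
      by (simp add: sum.distrib S_def flip: sum_distrib_left sum_divide_distrib)
    \<comment> \<open>An inequality and not an equation, also because \<open>S / S\<close> is 0 when
      \<open>S = 0\<close>.\<close>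
    also have "\<dots> \<le> (1 - p / q) * 1 + (p / q) * 1"
      using b exps by (intro add_mono mult_left_mono) auto
    finally show "(\<Sum>i<n. cmod (\<phi> (l' i)) powr p) \<le> 1"
      by simp
  qed
  moreover have "(\<Sum>i<n. cmod (l i (x i)) powr q) powr (1 / q) =
      (\<Sum>i<n. cmod (l' i (x i)) powr p) powr (1 / p)"
  proof -
    have "cmod (l' i (x i)) powr p = a i powr q * S powr (p / q - 1)" for i
    proof -
      have "cmod (l' i (x i)) powr p = (a i powr q / S) powr (1 - p / q) * (a i powr q) powr (p / q)"
        using \<open>c i \<ge> 0\<close> \<open>a i \<ge> 0\<close> assms
        by (simp add: l'_def norm_mult powr_mult cp powr_powr flip: a_def)
      also have "\<dots> = (a i powr q) powr (1 - p / q) * (a i powr q) powr (p / q) * S powr (p / q - 1)"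
        using \<open>S \<ge> 0\<close> powr_minus_divide[of S "1 - p / q"] by (simp add: powr_divide)
      also have "\<dots> = a i powr q * S powr (p / q - 1)"
        using powr_add[of "a i powr q" "1 - p / q" "p / q"] by simp
      finally show ?thesis .
    qed
    then have "(\<Sum>i<n. cmod (l' i (x i)) powr p) = S * S powr (p / q - 1)"
      by (simp add: S_def flip: sum_distrib_right)
    \<comment> \<open>If \<open>S = 0\<close>, both sides vanish. Taking the p-th root of the right
      side leaves \<open>S powr (1 / q)\<close>.\<close>
    also have "\<dots> = S powr (p / q)"
      using \<open>S \<ge> 0\<close> by (cases "S = 0") (simp_all add: powr_diff)
    finally show ?thesis
      using assms by (simp add: S_def a_def powr_powr)
  qed
  ultimately show "\<exists>l'\<in>{l. (\<forall>i<n. l i \<in> vecs (dual X)) \<and> weak_summing_norm p n (dual X) l \<le> 1}.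
      ennreal ((\<Sum>i<n. cmod (l i (x i)) powr q) powr (1 / q)) \<le>
      ennreal ((\<Sum>i<n. cmod (l' i (x i)) powr p) powr (1 / p))"
    using dual' by (intro bexI[of _ l']) simp_all
qed

text \<open>The same mean serves for both pairs of indices, because the assumed inequality holds for
  all tuples of every length.\<close>

lemma pq_amenable_transfer:
  assumes "pq_amenable m p q"
    and "\<And>n x. weak_pq_multi_norm p' q' n (bidual_L1 m) x \<le> weak_pq_multi_norm p q n (bidual_L1 m) x"
  shows "pq_amenable m p' q'"
proof -
  have "Sup {weak_pq_multi_norm p' q' n (bidual_L1 m) (\<lambda>i. bidual_action m (s i) \<Lambda>) |n s. n \<ge> 1} \<le>
      Sup {weak_pq_multi_norm p q n (bidual_L1 m) (\<lambda>i. bidual_action m (s i) \<Lambda>) |n s. n \<ge> 1}" for \<Lambda>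
    using assms(2) by (intro Sup_mono) blast
  then show ?thesis
    using assms(1) unfolding pq_amenable_def left_multi_invariant_def by (blast intro: le_less_trans)
qed

theorem mainTheorem3:
  fixes m :: "'a::{topological_group_add, t2_space} measure"
  assumes "locally_compact_space (euclidean :: 'a topology)"
    and "left_haar_measure m"
  shows "(\<forall>p q :: real. 1 < p \<and> p < q \<longrightarrow>
            (pq_amenable m q q \<longrightarrow> pq_amenable m p q) \<and>
            (pq_amenable m p q \<longrightarrow> pq_amenable m 1 q)) \<and>
         (\<forall>p :: real. 1 \<le> p \<longrightarrow> pq_amenable m p p \<longrightarrow>
            (\<forall>q :: real. p \<le> q \<longrightarrow> pq_amenable m q q))"
proof (intro conjI allI impI)
  fix p q :: real
  assume "1 < p \<and> p < q"
  then show "pq_amenable m p q" if "pq_amenable m q q"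
    by (intro pq_amenable_transfer[OF that] weak_pq_multi_norm_mono) auto
  show "pq_amenable m 1 q" if "pq_amenable m p q"
    using \<open>1 < p \<and> p < q\<close> by (intro pq_amenable_transfer[OF that] weak_pq_multi_norm_mono) auto
next
  fix p q :: real
  assume "1 \<le> p" "pq_amenable m p p" "p \<le> q"
  then show "pq_amenable m q q"
    using pq_amenable_transfer[OF _ weak_pp_multi_norm_antimono, of m p q] by simp
qed

end
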